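(* Assume A1, A2 and A3 (stated in the context). Let $L_1,\dots,L_N>0$ with $\sum_{i=1}^NL_i=1$. If $\xi^*\in\mathcal U_N$ is an optimal control for the regulator's problem with weights $L_1,\dots,L_N$, then $\xi^*$ is a Pareto-optimal policy for the $N$-player game.
   Context: Let $N,D$ be positive integers, $B=(B^1,\dots,B^D)$ a $D$-dimensional Brownian motion on a filtered probability space $(\Omega,\mathcal F,\{\mathcal F_t\}_{t\ge0},\mathbb P)$, $\mu=(\mu^1,\dots,\mu^N)\in\mathbb R^N$ and $\sigma\in\mathbb R^{N\times D}$ constant, $\sigma^i$ the $i$-th row of $\sigma$, with $\sigma\sigma^T\succeq\lambda I$ for some $\lambda>0$. Let $\rho>0$ and $K_i^+,K_i^->0$ ($1\le i\le N$). Admissible controls: $\mathcal U_N^i$ is the set of pairs $\xi^i=(\xi^{i,+},\xi^{i,-})$ of $\mathcal F_t$-progressively measurable, càdlàg, non-decreasing processes with $\xi^{i,\pm}_{0-}=0$ and $\mathbb E[\int_0^\infty e^{-\rho t}d\xi_t^{i,\pm}]<\infty$ (integrals include a possible jump at $t=0$). $\mathcal U_N=\prod_{i=1}^N\mathcal U_N^i$. A policy may depend on the initial state $x$; $J^i(x;\xi)$ is evaluated with the control that the policy prescribes from $x$. Dynamics: $dX_t^i=\mu^i dt+\sigma^i\cdot dB_t+d\xi_t^{i,+}-d\xi_t^{i,-}$, $X_{0-}^i=x^i$; $\mathbb E_x$ denotes expectation when $X_{0-}=x$. $N$-player game: player $i$ chooses $\xi^i\in\mathcal U_N^i$ to minimize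 $J^i(x;\xi)=\mathbb E_x\int_0^\infty e^{-\rho t}[h^i(X_t)dt+K_i^+d\xi_t^{i,+}+K_i^-d\xi_t^{i,-}]$, with $h^i:\mathbb R^N\to[0,\infty)$. Pareto optimality: $\xi^*\in\mathcal U_N$ is a Pareto-optimal policy for the game iff there does not exist $\xi\in\mathcal U_N$ such that, for all $x\in\mathbb R^N$, $J^i(x;\xi)\le J^i(x;\xi^* )$ for every $i\in\{1,\dots,N\}$ and $J^j(x;\xi)<J^j(x;\xi^* )$ for some $j\in\{1,\dots,N\}$. Regulator's problem with weights $L_i$: $H=\sum_{i=1}^N L_ih^i$, $J(x;\xi)=\sum_{i=1}^N L_iJ^i(x;\xi)$, $v(x)=\inf_{\xi\in\mathcal U_N}J(x;\xi)$; an optimal control is a policy $\xi^*$ with $J(x;\xi^* )=v(x)$ for every initial state $x$. Assumptions: there exist $C>c>0$ such that A1: $0\le H(x)\le C(1+\|x\|^2)$ for all $x\in\mathbb R^N$; A2: $|H(x)-H(x')|\le C(1+\|x\|+\|x'\|)\|x-x'\|$ for all $x,x'\in\mathbb R^N$; A3: $H\in\mathcal C^2(\mathbb R^N)$, $H$ is convex, and $0<c\le\partial_z^2H(x)\le C$ for every unit direction $z\in\mathbb R^N$ and all $x$. *)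

theory Defs
  imports "HOL-Probability.Probability"
begin

section \<open>Filtered probability spaces and Brownian motion\<close>

text \<open>Time is \<open>t \<ge> 0\<close>. Processes and filtrations are functions on all of \<^typ>\<open>real\<close>; nothing is
  required of them at negative times, and their values there are never used.\<close>

definition filtered_prob_space :: "'w measure \<Rightarrow> (real \<Rightarrow> 'w measure) \<Rightarrow> bool" where
  "filtered_prob_space M F \<longleftrightarrow>
     prob_space M \<and>
     (\<forall>t\<ge>0. subalgebra M (F t)) \<and>
     (\<forall>s t. 0 \<le> s \<and> s \<le> t \<longrightarrow> sets (F s) \<subseteq> sets (F t))"

definition brownian_motion ::
  "'w measure \<Rightarrow> (real \<Rightarrow> 'w measure) \<Rightarrow> (real \<Rightarrow> 'w \<Rightarrow> real ^ 'd) \<Rightarrow> bool" where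
  "brownian_motion M F B \<longleftrightarrow>
     (\<forall>t\<ge>0. B t \<in> borel_measurable (F t)) \<and>
     (AE \<omega> in M. B 0 \<omega> = 0) \<and>
     (AE \<omega> in M. continuous_on {0..} (\<lambda>t. B t \<omega>)) \<and>
     (\<forall>s t. 0 \<le> s \<and> s < t \<longrightarrow>
        prob_space.indep_set M (sets (F s))
          (sets (vimage_algebra (space M) (\<lambda>\<omega>. B t \<omega> - B s \<omega>) borel)) \<and>
        prob_space.indep_vars M (\<lambda>_. borel) (\<lambda>k \<omega>. (B t \<omega> - B s \<omega>) $ k) UNIV \<and>
        (\<forall>k. distributed M lborel (\<lambda>\<omega>. (B t \<omega> - B s \<omega>) $ k) (normal_density 0 (sqrt (t - s)))))"

section \<open>Admissible controls\<close>

definition progressively_measurable ::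
  "(real \<Rightarrow> 'w measure) \<Rightarrow> (real \<Rightarrow> 'w \<Rightarrow> real) \<Rightarrow> bool" where
  "progressively_measurable F Y \<longleftrightarrow>
     (\<forall>t\<ge>0. (\<lambda>(s, \<omega>). Y s \<omega>) \<in> borel_measurable (restrict_space borel {0..t} \<Otimes>\<^sub>M F t))"

definition cadlag :: "(real \<Rightarrow> real) \<Rightarrow> bool" where
  "cadlag f \<longleftrightarrow>
     (\<forall>t\<ge>0. (f \<longlongrightarrow> f t) (at_right t)) \<and>
     (\<forall>t>0. \<exists>l. (f \<longlongrightarrow> l) (at_left t))"

text \<open>The measure \<open>df\<close> on \<open>[0, \<infinity>)\<close> of a path with \<open>f(0-) = 0\<close>: extending the path by zero to
  negative times makes the point 0 carry the mass \<open>f 0\<close> of the initial jump.\<close>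

definition path_measure :: "(real \<Rightarrow> real) \<Rightarrow> real measure" where
  "path_measure f = interval_measure (\<lambda>t. if t < 0 then 0 else f t)"

definition discounted_variation :: "real \<Rightarrow> (real \<Rightarrow> real) \<Rightarrow> ennreal" where
  "discounted_variation \<rho> f = (\<integral>\<^sup>+ t\<in>{0..}. ennreal (exp (- \<rho> * t)) \<partial>path_measure f)"

text \<open>The condition \<open>0 \<le> Y 0 \<omega>\<close> is monotonicity across the initial jump from \<open>Y(0-) = 0\<close>.\<close>

definition increasing_control ::
  "'w measure \<Rightarrow> (real \<Rightarrow> 'w measure) \<Rightarrow> real \<Rightarrow> (real \<Rightarrow> 'w \<Rightarrow> real) \<Rightarrow> bool" where
  "increasing_control M F \<rho> Y \<longleftrightarrow>
     progressively_measurable F Y \<and>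
     (\<forall>\<omega>\<in>space M. cadlag (\<lambda>t. Y t \<omega>) \<and> mono_on {0..} (\<lambda>t. Y t \<omega>) \<and> 0 \<le> Y 0 \<omega>) \<and>
     (\<integral>\<^sup>+ \<omega>. discounted_variation \<rho> (\<lambda>t. Y t \<omega>) \<partial>M) < \<infinity>"

type_synonym 'w control = "(real \<Rightarrow> 'w \<Rightarrow> real) \<times> (real \<Rightarrow> 'w \<Rightarrow> real)"

definition player_controls ::
  "'w measure \<Rightarrow> (real \<Rightarrow> 'w measure) \<Rightarrow> real \<Rightarrow> 'w control set" where
  "player_controls M F \<rho> =
     {(Yp, Ym). increasing_control M F \<rho> Yp \<and> increasing_control M F \<rho> Ym}"

definition admissible_controls ::
  "'w measure \<Rightarrow> (real \<Rightarrow> 'w measure) \<Rightarrow> real \<Rightarrow> ('n::finite \<Rightarrow> 'w control) set" where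
  "admissible_controls M F \<rho> = {\<xi>. \<forall>i. \<xi> i \<in> player_controls M F \<rho>}"

section \<open>Dynamics and costs\<close>

definition state ::
  "real ^ 'n \<Rightarrow> real ^ 'd ^ 'n \<Rightarrow> (real \<Rightarrow> 'w \<Rightarrow> real ^ 'd) \<Rightarrow> real ^ 'n \<Rightarrow>
    ('n::finite \<Rightarrow> 'w control) \<Rightarrow> real \<Rightarrow> 'w \<Rightarrow> real ^ 'n" where
  "state \<mu> \<sigma> B x \<xi> t \<omega> =
     (\<chi> i. x $ i + \<mu> $ i * t + (\<sigma> $ i) \<bullet> B t \<omega> + fst (\<xi> i) t \<omega> - snd (\<xi> i) t \<omega>)"

definition player_cost ::
  "'w measure \<Rightarrow> real ^ 'n \<Rightarrow> real ^ 'd ^ 'n \<Rightarrow> (real \<Rightarrow> 'w \<Rightarrow> real ^ 'd) \<Rightarrow> real \<Rightarrow>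
    ('n \<Rightarrow> real ^ 'n \<Rightarrow> real) \<Rightarrow> ('n \<Rightarrow> real) \<Rightarrow> ('n \<Rightarrow> real) \<Rightarrow>
    'n::finite \<Rightarrow> real ^ 'n \<Rightarrow> ('n \<Rightarrow> 'w control) \<Rightarrow> ennreal" where
  "player_cost M \<mu> \<sigma> B \<rho> h Kp Km i x \<xi> =
     (\<integral>\<^sup>+ \<omega>.
        (\<integral>\<^sup>+ t\<in>{0..}. ennreal (exp (- \<rho> * t) * h i (state \<mu> \<sigma> B x \<xi> t \<omega>)) \<partial>lborel)
        + ennreal (Kp i) * discounted_variation \<rho> (\<lambda>t. fst (\<xi> i) t \<omega>)
        + ennreal (Km i) * discounted_variation \<rho> (\<lambda>t. snd (\<xi> i) t \<omega>) \<partial>M)"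

section \<open>Pareto optimality and the regulator's problem\<close>

text \<open>A policy assigns a control to every initial state; \<open>J i x \<xi>\<close> is the cost of player \<open>i\<close> from
  \<open>x\<close> under the control \<open>\<xi>\<close>.\<close>

definition policies :: "'c set \<Rightarrow> ('x \<Rightarrow> 'c) set" where
  "policies U = {\<pi>. \<forall>x. \<pi> x \<in> U}"

definition pareto_optimal :: "'c set \<Rightarrow> ('n \<Rightarrow> 'x \<Rightarrow> 'c \<Rightarrow> ennreal) \<Rightarrow> ('x \<Rightarrow> 'c) \<Rightarrow> bool" where
  "pareto_optimal U J \<pi>' \<longleftrightarrow>
     \<pi>' \<in> policies U \<and>
     \<not> (\<exists>\<pi>\<in>policies U. \<forall>x. (\<forall>i. J i x (\<pi> x) \<le> J i x (\<pi>' x)) \<and>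
                             (\<exists>j. J j x (\<pi> x) < J j x (\<pi>' x)))"

definition regulator_cost ::
  "('n::finite \<Rightarrow> real) \<Rightarrow> ('n \<Rightarrow> 'x \<Rightarrow> 'c \<Rightarrow> ennreal) \<Rightarrow> 'x \<Rightarrow> 'c \<Rightarrow> ennreal" where
  "regulator_cost L J x \<xi> = (\<Sum>i\<in>UNIV. ennreal (L i) * J i x \<xi>)"

definition value_function :: "'c set \<Rightarrow> ('x \<Rightarrow> 'c \<Rightarrow> ennreal) \<Rightarrow> 'x \<Rightarrow> ennreal" where
  "value_function U J x = (INF \<xi>\<in>U. J x \<xi>)"

definition optimal_control :: "'c set \<Rightarrow> ('x \<Rightarrow> 'c \<Rightarrow> ennreal) \<Rightarrow> ('x \<Rightarrow> 'c) \<Rightarrow> bool" where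
  "optimal_control U J \<pi> \<longleftrightarrow> \<pi> \<in> policies U \<and> (\<forall>x. J x (\<pi> x) = value_function U J x)"

section \<open>Assumptions on the aggregate running cost\<close>

definition aggregate_cost ::
  "('n::finite \<Rightarrow> real) \<Rightarrow> ('n \<Rightarrow> 'x \<Rightarrow> real) \<Rightarrow> 'x \<Rightarrow> real" where
  "aggregate_cost L h x = (\<Sum>i\<in>UNIV. L i * h i x)"

definition C2_function :: "('a::real_normed_vector \<Rightarrow> real) \<Rightarrow> bool" where
  "C2_function f \<longleftrightarrow>
     (\<exists>(f' :: 'a \<Rightarrow> 'a \<Rightarrow>\<^sub>L real) (f'' :: 'a \<Rightarrow> 'a \<Rightarrow>\<^sub>L 'a \<Rightarrow>\<^sub>L real).
        (\<forall>x. (f has_derivative blinfun_apply (f' x)) (at x)) \<and>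
        (\<forall>x. (f' has_derivative blinfun_apply (f'' x)) (at x)) \<and>
        continuous_on UNIV f'')"

definition directional_deriv :: "'a::real_vector \<Rightarrow> ('a \<Rightarrow> real) \<Rightarrow> 'a \<Rightarrow> real" where
  "directional_deriv z f x = deriv (\<lambda>s. f (x + s *\<^sub>R z)) 0"

definition assumption_A1 :: "real \<Rightarrow> ('a::real_normed_vector \<Rightarrow> real) \<Rightarrow> bool" where
  "assumption_A1 C H \<longleftrightarrow> (\<forall>x. 0 \<le> H x \<and> H x \<le> C * (1 + (norm x)\<^sup>2))"

definition assumption_A2 :: "real \<Rightarrow> ('a::real_normed_vector \<Rightarrow> real) \<Rightarrow> bool" where
  "assumption_A2 C H \<longleftrightarrow>
     (\<forall>x x'. \<bar>H x - H x'\<bar> \<le> C * (1 + norm x + norm x') * norm (x - x'))"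

definition assumption_A3 :: "real \<Rightarrow> real \<Rightarrow> ('a::real_normed_vector \<Rightarrow> real) \<Rightarrow> bool" where
  "assumption_A3 c C H \<longleftrightarrow>
     C2_function H \<and> convex_on UNIV H \<and>
     (\<forall>z x. norm z = 1 \<longrightarrow>
        c \<le> directional_deriv z (directional_deriv z H) x \<and>
        directional_deriv z (directional_deriv z H) x \<le> C)"

end

theory Submission
  imports Defs
begin

text \<open>
  This is the scalarisation principle: with strictly positive weights, a policy that is nowhere worse
  for any player and somewhere better for one player has a strictly smaller weighted cost, which is
  impossible if the given policy already minimises the weighted cost. An improvement in the sense of
  Pareto is required from every initial state, so contradicting it at one state is enough.

  The costs take values in \<open>[0, \<infinity>]\<close>, and strictness is lost where a weighted cost is infinite. The
  principle (\<open>regulator_optimal_imp_pareto_optimal\<close>) therefore needs a state with a finite value, and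
  the analytic content is that the origin is such a state. There the value is at most the weighted
  cost of the control that never acts, for which the state is a Brownian motion with drift. By A1 and
  \<open>h\<^sup>i \<ge> 0\<close> each running cost grows at most quadratically, \<open>L\<^sub>i h\<^sup>i \<le> H \<le> C (1 + \<parallel>x\<parallel>\<^sup>2)\<close>, while
  the mean of \<open>\<parallel>B\<^sub>t\<parallel>\<^sup>2\<close> is \<open>D t\<close>, which is beaten by the discount factor.

  The last step exchanges expectation and time integral. Joint measurability of \<open>(t, \<omega>) \<mapsto> B\<^sub>t(\<omega>)\<close>
  is not part of the definition of Brownian motion, and the individual \<open>h\<^sup>i\<close> may fail to be
  measurable. Both are circumvented: the passive cost is first bounded pointwise by a quadratic
  expression in \<open>B\<^sub>t\<close>, and the expectation of its time integral is then estimated through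
  discretised paths and Fatou's lemma (\<open>nn_integral_continuous_process_le\<close>).
\<close>

section \<open>Minimisers of a weighted sum of costs\<close>

text \<open>Finiteness of the larger cost is essential: an infinite term of another player would absorb the
  strict improvement of player \<open>j\<close>.\<close>

lemma regulator_cost_strict_mono:
  fixes J :: "'n::finite \<Rightarrow> 'x \<Rightarrow> 'c \<Rightarrow> ennreal"
  assumes L: "\<And>i. 0 < L i"
    and le: "\<And>i. J i x \<xi> \<le> J i x \<zeta>"
    and less: "J j x \<xi> < J j x \<zeta>"
    and finite: "regulator_cost L J x \<zeta> < \<top>"
  shows "regulator_cost L J x \<xi> < regulator_cost L J x \<zeta>"
proof -
  let ?r = "\<lambda>\<eta>. \<Sum>i\<in>UNIV - {j}. ennreal (L i) * J i x \<eta>"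
  have split: "regulator_cost L J x \<eta> = ?r \<eta> + ennreal (L j) * J j x \<eta>" for \<eta>
    unfolding regulator_cost_def by (subst sum.remove[of _ j]) (auto simp: add.commute)
  have rest: "?r \<xi> \<le> ?r \<zeta>"
    by (intro sum_mono mult_left_mono le) auto
  have "?r \<zeta> < \<top>"
    using finite unfolding split by simp
  with rest have fin: "?r \<xi> < \<top>"
    by (rule le_less_trans)
  have "ennreal (L j) * J j x \<xi> < ennreal (L j) * J j x \<zeta>"
    using less L[of j] by (intro ennreal_mult_strict_left_mono) auto
  then have "?r \<xi> + ennreal (L j) * J j x \<xi> < ?r \<xi> + ennreal (L j) * J j x \<zeta>"
    using fin unfolding ennreal_add_left_cancel_less by (simp only: infinity_ennreal_def less_top simp_thms)
  also have "\<dots> \<le> ?r \<zeta> + ennreal (L j) * J j x \<zeta>"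
    using rest by (rule add_right_mono)
  finally show ?thesis
    unfolding split .
qed

lemma regulator_optimal_imp_pareto_optimal:
  fixes J :: "'n::finite \<Rightarrow> 'x \<Rightarrow> 'c \<Rightarrow> ennreal"
  assumes L: "\<And>i. 0 < L i"
    and opt: "optimal_control U (regulator_cost L J) \<pi>'"
    and finite: "value_function U (regulator_cost L J) x < \<top>"
  shows "pareto_optimal U J \<pi>'"
  unfolding pareto_optimal_def
proof (intro conjI notI)
  show "\<pi>' \<in> policies U"
    using opt by (simp add: optimal_control_def)
  assume "\<exists>\<pi>\<in>policies U. \<forall>x. (\<forall>i. J i x (\<pi> x) \<le> J i x (\<pi>' x)) \<and>
                             (\<exists>j. J j x (\<pi> x) < J j x (\<pi>' x))"
  then obtain \<pi> j where "\<pi> \<in> policies U" and le: "\<And>i. J i x (\<pi> x) \<le> J i x (\<pi>' x)"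
    and less: "J j x (\<pi> x) < J j x (\<pi>' x)"
    by blast
  have eq: "regulator_cost L J x (\<pi>' x) = value_function U (regulator_cost L J) x"
    using opt by (simp add: optimal_control_def)
  have "regulator_cost L J x (\<pi> x) < regulator_cost L J x (\<pi>' x)"
    using regulator_cost_strict_mono[where J = J and L = L, OF L le less] finite by (simp add: eq)
  moreover have "value_function U (regulator_cost L J) x \<le> regulator_cost L J x (\<pi> x)"
    unfolding value_function_def using \<open>\<pi> \<in> policies U\<close>
    by (intro INF_lower) (simp add: policies_def)
  ultimately show False
    by (simp add: eq)
qed

section \<open>The control that never acts\<close>

text \<open>The Stieltjes measure of the zero path vanishes on each interval \<open>(-n, n]\<close>, hence everywhere.\<close>

lemma discounted_variation_zero: "discounted_variation \<rho> (\<lambda>_. 0) = 0"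
proof -
  let ?M = "path_measure (\<lambda>_. 0)"
  have M: "?M = interval_measure (\<lambda>_. 0)"
    by (simp add: path_measure_def)
  have Ioc: "emeasure ?M {- real n <.. real n} = 0" for n
    unfolding M by (subst emeasure_interval_measure_Ioc) auto
  have "emeasure ?M (\<Union>n. {- real n <.. real n}) = 0"
    by (rule emeasure_UN_eq_0[OF Ioc]) (auto simp: M)
  moreover have "(\<Union>n. {- real n <.. real n}) = UNIV"
  proof (intro equalityI subsetI UNIV_I)
    fix x :: real
    obtain n where "\<bar>x\<bar> < real n"
      using reals_Archimedean2 by blast
    then show "x \<in> (\<Union>n. {- real n <.. real n})"
      by (intro UN_I[of n]) auto
  qed
  ultimately have "AE t in ?M. False"
    by (intro AE_I[of _ _ UNIV]) (auto simp: M)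
  then have "discounted_variation \<rho> (\<lambda>_. 0) = (\<integral>\<^sup>+ t. 0 \<partial>?M)"
    unfolding discounted_variation_def by (intro nn_integral_cong_AE) (auto elim: eventually_mono)
  then show ?thesis
    by simp
qed

lemma zero_control_admissible:
  "(\<lambda>_. (\<lambda>_ _. 0, \<lambda>_ _. 0)) \<in> admissible_controls M F \<rho>"
proof -
  have "increasing_control M F \<rho> (\<lambda>_ _. 0)"
    by (auto simp: increasing_control_def progressively_measurable_def cadlag_def mono_on_def
        discounted_variation_zero)
  then show ?thesis
    by (simp add: admissible_controls_def player_controls_def)
qed

section \<open>Exchanging expectation and time integral\<close>

lemma floor_grid_tendsto:
  fixes t :: real
  assumes "0 \<le> t"
  shows "(\<lambda>n. real (nat \<lfloor>t * real (Suc n)\<rfloor>) / real (Suc n)) \<longlonglongrightarrow> t"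
proof (rule tendsto_sandwich)
  have fl: "real (nat \<lfloor>t * real (Suc n)\<rfloor>) = of_int \<lfloor>t * real (Suc n)\<rfloor>" for n
    using assms by simp
  show "\<forall>\<^sub>F n in sequentially.
      t - 1 / real (Suc n) \<le> real (nat \<lfloor>t * real (Suc n)\<rfloor>) / real (Suc n)"
  proof (rule always_eventually, rule allI)
    fix n
    have "t * real (Suc n) - 1 \<le> of_int \<lfloor>t * real (Suc n)\<rfloor>"
      by linarith
    then have "(t * real (Suc n) - 1) / real (Suc n)
        \<le> of_int \<lfloor>t * real (Suc n)\<rfloor> / real (Suc n)"
      by (rule divide_right_mono) simp
    then show "t - 1 / real (Suc n) \<le> real (nat \<lfloor>t * real (Suc n)\<rfloor>) / real (Suc n)"
      unfolding fl by (simp add: diff_divide_distrib del: of_nat_Suc)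
  qed
  show "\<forall>\<^sub>F n in sequentially. real (nat \<lfloor>t * real (Suc n)\<rfloor>) / real (Suc n) \<le> t"
    unfolding fl by (intro always_eventually allI) (simp add: pos_divide_le_eq del: of_nat_Suc)
  have "(\<lambda>n. t - 1 / real (Suc n)) \<longlonglongrightarrow> t - 0"
    by (intro tendsto_diff tendsto_const LIMSEQ_Suc[OF lim_1_over_n])
  then show "(\<lambda>n. t - 1 / real (Suc n)) \<longlonglongrightarrow> t" 
    by simp
qed simp

text \<open>One half of Tonelli's theorem for a process with continuous paths that is not known to be jointly
  measurable. Evaluating the process at the last grid point up to \<open>t\<close> gives, for every mesh,
  a jointly measurable process, to which Tonelli's theorem applies; continuity of the paths and
  Fatou's lemma then bound the original integral. Monotonicity of the bound \<open>m\<close> passes from the grid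
  point, which does not exceed \<open>t\<close>, to \<open>t\<close> itself. The integrand over \<open>\<omega>\<close> on the left need not be
  measurable, because Fatou's lemma in the time variable is applied path by path.\<close>

lemma (in sigma_finite_measure) nn_integral_continuous_process_le:
  fixes Z :: "real \<Rightarrow> 'a \<Rightarrow> real" and w m :: "real \<Rightarrow> real"
  assumes Z [measurable]: "\<And>t. 0 \<le> t \<Longrightarrow> Z t \<in> borel_measurable M"
    and cont: "AE \<omega> in M. continuous_on {0..} (\<lambda>t. Z t \<omega>)"
    and w [measurable]: "w \<in> borel_measurable borel"
    and mean: "\<And>t. 0 \<le> t \<Longrightarrow> (\<integral>\<^sup>+ \<omega>. ennreal (Z t \<omega>) \<partial>M) \<le> ennreal (m t)"
    and mono: "mono_on {0..} m"
  shows "(\<integral>\<^sup>+ \<omega>. (\<integral>\<^sup>+ t\<in>{0..}. ennreal (w t) * ennreal (Z t \<omega>) \<partial>lborel) \<partial>M)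
    \<le> (\<integral>\<^sup>+ t\<in>{0..}. ennreal (w t) * ennreal (m t) \<partial>lborel)"
proof -
  interpret P: pair_sigma_finite lborel M ..
  define g where "g n t = real (nat \<lfloor>t * real (Suc n)\<rfloor>) / real (Suc n)" for n and t :: real
  define f where "f n t \<omega> = ennreal (w t) * ennreal (Z (g n t) \<omega>) * indicator {0..} t" for n t \<omega>
  have g0: "0 \<le> g n t" for n t
    by (simp add: g_def)
  have gle: "g n t \<le> t" if "0 \<le> t" for n t
    using that by (simp add: g_def pos_divide_le_eq del: of_nat_Suc)
  \<comment> \<open>For each mesh only countably many of the random variables \<open>Z s\<close> enter.\<close>
  have Zg: "(\<lambda>p. Z (g n (fst p)) (snd p)) \<in> borel_measurable (lborel \<Otimes>\<^sub>M M)" for n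
    unfolding g_def
  proof (rule measurable_compose_countable[where f = "\<lambda>k p. Z (real k / real (Suc n)) (snd p)"])
    show "(\<lambda>p. Z (real k / real (Suc n)) (snd p)) \<in> borel_measurable (lborel \<Otimes>\<^sub>M M)" for k
      by (rule measurable_compose[OF measurable_snd Z]) simp
    show "(\<lambda>p. nat \<lfloor>fst p * real (Suc n)\<rfloor>) \<in> lborel \<Otimes>\<^sub>M M \<rightarrow>\<^sub>M count_space UNIV"
      by measurable
  qed
  have f [measurable]: "case_prod (f n) \<in> borel_measurable (lborel \<Otimes>\<^sub>M M)" for n
    using Zg[of n] unfolding f_def split_beta' by measurable
  have path: "(\<integral>\<^sup>+ t\<in>{0..}. ennreal (w t) * ennreal (Z t \<omega>) \<partial>lborel)
      \<le> liminf (\<lambda>n. \<integral>\<^sup>+ t. f n t \<omega> \<partial>lborel)"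
    if \<omega>: "\<omega> \<in> space M" and c: "continuous_on {0..} (\<lambda>t. Z t \<omega>)" for \<omega>
  proof -
    have lim: "(\<lambda>n. f n t \<omega>) \<longlonglongrightarrow> ennreal (w t) * ennreal (Z t \<omega>) * indicator {0..} t" for t
    proof (cases "0 \<le> t")
      case True
      have "(\<lambda>n. Z (g n t) \<omega>) \<longlonglongrightarrow> Z t \<omega>"
        using c floor_grid_tendsto[OF True] True g0
        by (intro continuous_on_tendsto_compose[OF c]) (auto simp: g_def)
      then show ?thesis
        using True unfolding f_def
        by (auto intro!: ennreal_tendsto_cmult)
    qed (simp add: f_def)
    have "(\<integral>\<^sup>+ t\<in>{0..}. ennreal (w t) * ennreal (Z t \<omega>) \<partial>lborel)
        = (\<integral>\<^sup>+ t. liminf (\<lambda>n. f n t \<omega>) \<partial>lborel)"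
      using lim by (intro nn_integral_cong) (metis lim_imp_Liminf trivial_limit_sequentially)
    also have "\<dots> \<le> liminf (\<lambda>n. \<integral>\<^sup>+ t. f n t \<omega> \<partial>lborel)"
      using \<omega> by (intro nn_integral_liminf) measurable
    finally show ?thesis .
  qed
  have "(\<integral>\<^sup>+ \<omega>. (\<integral>\<^sup>+ t\<in>{0..}. ennreal (w t) * ennreal (Z t \<omega>) \<partial>lborel) \<partial>M)
      \<le> (\<integral>\<^sup>+ \<omega>. liminf (\<lambda>n. \<integral>\<^sup>+ t. f n t \<omega> \<partial>lborel) \<partial>M)"
    using cont path by (intro nn_integral_mono_AE) auto
  also have "\<dots> \<le> liminf (\<lambda>n. \<integral>\<^sup>+ \<omega>. (\<integral>\<^sup>+ t. f n t \<omega> \<partial>lborel) \<partial>M)"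
    by (intro nn_integral_liminf) measurable
  also have "\<dots> \<le> (\<integral>\<^sup>+ t\<in>{0..}. ennreal (w t) * ennreal (m t) \<partial>lborel)"
  proof (rule Liminf_le[OF _ always_eventually[rule_format]])
    fix n
    have "(\<integral>\<^sup>+ \<omega>. (\<integral>\<^sup>+ t. f n t \<omega> \<partial>lborel) \<partial>M) = (\<integral>\<^sup>+ t. (\<integral>\<^sup>+ \<omega>. f n t \<omega> \<partial>M) \<partial>lborel)"
      by (rule P.Fubini') (rule f)
    also have "\<dots> \<le> (\<integral>\<^sup>+ t\<in>{0..}. ennreal (w t) * ennreal (m t) \<partial>lborel)"
    proof (rule nn_integral_mono)
      fix t :: real
      show "(\<integral>\<^sup>+ \<omega>. f n t \<omega> \<partial>M) \<le> ennreal (w t) * ennreal (m t) * indicator {0..} t"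
      proof (cases "0 \<le> t")
        case True
        have "(\<integral>\<^sup>+ \<omega>. ennreal (Z (g n t) \<omega>) \<partial>M) \<le> ennreal (m (g n t))"
          by (rule mean[OF g0])
        also have "\<dots> \<le> ennreal (m t)"
          using mono_onD[OF mono _ _ gle[OF True]] True g0 by (intro ennreal_leI) auto
        finally show ?thesis
          using True Z[OF g0] unfolding f_def
          by (auto simp: nn_integral_cmult intro!: mult_left_mono)
      qed (simp add: f_def)
    qed
    finally show "(\<integral>\<^sup>+ \<omega>. (\<integral>\<^sup>+ t. f n t \<omega> \<partial>lborel) \<partial>M)
        \<le> (\<integral>\<^sup>+ t\<in>{0..}. ennreal (w t) * ennreal (m t) \<partial>lborel)" .
  qed simp
  finally show ?thesis .
qed

section \<open>Second moments of Brownian motion\<close>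

lemma (in prob_space) nn_integral_square_centred_normal:
  assumes "0 < s" and D: "distributed M lborel X (normal_density 0 s)"
  shows "(\<integral>\<^sup>+ \<omega>. ennreal ((X \<omega>)\<^sup>2) \<partial>M) = ennreal (s\<^sup>2)"
proof -
  have moment: "has_bochner_integral lborel (\<lambda>x. normal_density 0 s x * x\<^sup>2) (s\<^sup>2)"
    using normal_moment_even[OF \<open>0 < s\<close>, of 0 1] by simp
  have "(\<integral>\<^sup>+ \<omega>. ennreal ((X \<omega>)\<^sup>2) \<partial>M)
      = (\<integral>\<^sup>+ x. ennreal (normal_density 0 s x) * ennreal (x\<^sup>2) \<partial>lborel)"
    by (rule distributed_nn_integral[OF D, symmetric]) simp
  also have "\<dots> = (\<integral>\<^sup>+ x. ennreal (normal_density 0 s x * x\<^sup>2) \<partial>lborel)"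
    by (simp add: ennreal_mult)
  also have "\<dots> = ennreal (s\<^sup>2)"
    using moment by (subst nn_integral_eq_integral) (auto simp: has_bochner_integral_iff)
  finally show ?thesis .
qed

text \<open>Up to a null set \<open>B t\<close> is the increment \<open>B t - B 0\<close>, whose coordinates are centred normal with
  variance \<open>t\<close>. The case \<open>t = 0\<close> is separate, since only increments over intervals of positive length
  have a density.\<close>

lemma brownian_motion_second_moment:
  fixes B :: "real \<Rightarrow> 'w \<Rightarrow> real ^ 'd"
  assumes F: "filtered_prob_space M F" and B: "brownian_motion M F B" and t: "0 \<le> t"
  shows "(\<integral>\<^sup>+ \<omega>. ennreal ((norm (B t \<omega>))\<^sup>2) \<partial>M) = ennreal (real CARD('d) * t)"
proof -
  interpret prob_space M
    using F by (simp add: filtered_prob_space_def)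
  have B0: "AE \<omega> in M. B 0 \<omega> = 0"
    using B by (simp add: brownian_motion_def)
  show ?thesis
  proof (cases "t = 0")
    case True
    have "(\<integral>\<^sup>+ \<omega>. ennreal ((norm (B t \<omega>))\<^sup>2) \<partial>M) = (\<integral>\<^sup>+ \<omega>. 0 \<partial>M)"
      using B0 by (intro nn_integral_cong_AE) (auto simp: True)
    then show ?thesis
      by (simp add: True)
  next
    case False
    with t have t: "0 < t" by simp
    have D: "distributed M lborel (\<lambda>\<omega>. (B t \<omega> - B 0 \<omega>) $ k) (normal_density 0 (sqrt t))" for k
    proof -
      have "\<forall>s t. 0 \<le> s \<and> s < t \<longrightarrow> (\<forall>k. distributed M lborel (\<lambda>\<omega>. (B t \<omega> - B s \<omega>) $ k)
          (normal_density 0 (sqrt (t - s))))"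
        using B unfolding brownian_motion_def by blast
      from this[rule_format, of 0 t k] t show ?thesis
        by simp
    qed
    have meas [measurable]: "(\<lambda>\<omega>. (B t \<omega> - B 0 \<omega>) $ k) \<in> borel_measurable M" for k
      using distributed_measurable[OF D[of k]] by simp
    have "(\<integral>\<^sup>+ \<omega>. ennreal ((norm (B t \<omega>))\<^sup>2) \<partial>M)
        = (\<integral>\<^sup>+ \<omega>. (\<Sum>k\<in>UNIV. ennreal (((B t \<omega> - B 0 \<omega>) $ k)\<^sup>2)) \<partial>M)"
      using B0
      by (intro nn_integral_cong_AE)
         (auto simp: norm_vec_def L2_set_def sum_nonneg elim!: eventually_mono)
    also have "\<dots> = (\<Sum>k\<in>(UNIV :: 'd set). ennreal ((sqrt t)\<^sup>2))"
      using t by (subst nn_integral_sum)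
        (auto simp: nn_integral_square_centred_normal[OF _ D] simp del: vector_minus_component)
    also have "\<dots> = ennreal (real CARD('d) * t)"
      using t by (simp add: ennreal_mult ennreal_of_nat_eq_real_of_nat)
    finally show ?thesis .
  qed
qed

section \<open>The passive cost is finite\<close>

text \<open>Up to the factor \<open>1 / \<rho>\<close> this is a moment of the exponential distribution.\<close>

lemma nn_integral_exp_times_power_finite:
  fixes \<rho> :: real
  assumes "0 < \<rho>"
  shows "(\<integral>\<^sup>+ t\<in>{0..}. ennreal (exp (- \<rho> * t)) * ennreal (t ^ k) \<partial>lborel) < \<top>"
proof -
  have "(\<integral>\<^sup>+ t\<in>{0..}. ennreal (exp (- \<rho> * t)) * ennreal (t ^ k) \<partial>lborel)
      = (\<integral>\<^sup>+ t. ennreal (1 / \<rho>) * ennreal (erlang_density 0 \<rho> t * t ^ k) \<partial>lborel)"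
    using assms
    by (intro nn_integral_cong)
       (auto simp: erlang_density_def ennreal_mult[symmetric] split: split_indicator)
  also have "\<dots> = ennreal (1 / \<rho>) * ennreal (fact k / \<rho> ^ k)"
    using nn_integral_erlang_ith_moment[OF assms, of 0 k] by (subst nn_integral_cmult) auto
  also have "\<dots> < \<top>"
    by (simp add: ennreal_mult_less_top)
  finally show ?thesis .
qed

text \<open>The mean of the second factor is a polynomial in \<open>t\<close>, and the exponential weight integrates every
  power of \<open>t\<close>. The constant \<open>A\<close> belongs to the weight because the inner integral is not known to be
  measurable in \<open>\<omega>\<close>; it is pulled out only after the expectation has been taken.\<close>

lemma discounted_quadratic_growth_finite:
  fixes B :: "real \<Rightarrow> 'w \<Rightarrow> real ^ 'd"
  assumes F: "filtered_prob_space M F" and B: "brownian_motion M F B" and \<rho>: "0 < \<rho>"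
    and A: "0 \<le> A"
  shows "(\<integral>\<^sup>+ \<omega>. (\<integral>\<^sup>+ t\<in>{0..}. ennreal (A * exp (- \<rho> * t)) *
            ennreal (1 + t\<^sup>2 + (norm (B t \<omega>))\<^sup>2) \<partial>lborel) \<partial>M) < \<top>"
    (is "?lhs < \<top>")
proof -
  interpret prob_space M
    using F by (simp add: filtered_prob_space_def)
  let ?m = "\<lambda>t. 1 + t\<^sup>2 + real CARD('d) * t"
  define q where "q k t = ennreal (exp (- \<rho> * t)) * ennreal (t ^ k) * indicator {0..} t"
    for k :: nat and t
  have [measurable]: "q k \<in> borel_measurable borel" for k
    unfolding q_def by measurable
  have q_finite: "integral\<^sup>N lborel (q k) < \<top>" for k
    unfolding q_def by (rule nn_integral_exp_times_power_finite[OF \<rho>])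
  have sub: "subalgebra M (F t)" if "0 \<le> t" for t
    using F that by (simp add: filtered_prob_space_def)
  have meas: "B t \<in> borel_measurable M" if "0 \<le> t" for t
    using B that by (intro measurable_from_subalg[OF sub[OF that]]) (simp add: brownian_motion_def)
  have "?lhs \<le> (\<integral>\<^sup>+ t\<in>{0..}. ennreal (A * exp (- \<rho> * t)) * ennreal (?m t) \<partial>lborel)"
  proof (rule nn_integral_continuous_process_le)
    show "(\<lambda>\<omega>. 1 + t\<^sup>2 + (norm (B t \<omega>))\<^sup>2) \<in> borel_measurable M" if "0 \<le> t" for t
      using meas[OF that] by measurable
    have "AE \<omega> in M. continuous_on {0..} (\<lambda>t. B t \<omega>)"
      using B by (simp add: brownian_motion_def)
    then show "AE \<omega> in M. continuous_on {0..} (\<lambda>t. 1 + t\<^sup>2 + (norm (B t \<omega>))\<^sup>2)"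
      by (rule eventually_mono) (intro continuous_intros)
    show "(\<integral>\<^sup>+ \<omega>. ennreal (1 + t\<^sup>2 + (norm (B t \<omega>))\<^sup>2) \<partial>M) \<le> ennreal (?m t)"
      if t: "0 \<le> t" for t
    proof -
      have "(\<integral>\<^sup>+ \<omega>. ennreal (1 + t\<^sup>2 + (norm (B t \<omega>))\<^sup>2) \<partial>M)
          = (\<integral>\<^sup>+ \<omega>. ennreal (1 + t\<^sup>2) + ennreal ((norm (B t \<omega>))\<^sup>2) \<partial>M)"
        by (intro nn_integral_cong ennreal_plus) auto
      also have "\<dots> = ennreal (1 + t\<^sup>2) + ennreal (real CARD('d) * t)"
        using meas[OF t] brownian_motion_second_moment[OF F B t]
        by (subst nn_integral_add) (simp_all add: emeasure_space_1)
      also have "\<dots> = ennreal (?m t)"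
        using t by (intro ennreal_plus[symmetric]) auto
      finally show ?thesis
        by simp
    qed
    show "mono_on {0..} ?m"
      by (intro mono_onI add_mono mult_left_mono power_mono) auto
  qed measurable
  also have "\<dots> = (\<integral>\<^sup>+ t. ennreal A * ((q 0 t + q 2 t) + ennreal (real CARD('d)) * q 1 t) \<partial>lborel)"
  proof (rule nn_integral_cong)
    fix t :: real
    show "ennreal (A * exp (- \<rho> * t)) * ennreal (?m t) * indicator {0..} t =
        ennreal A * ((q 0 t + q 2 t) + ennreal (real CARD('d)) * q 1 t)"
    proof (cases "0 \<le> t")
      case True
      then have m: "ennreal (?m t)
          = ennreal (t ^ 0) + ennreal (t ^ 2) + ennreal (real CARD('d)) * ennreal (t ^ 1)"
        by (simp add: ennreal_mult')
      show ?thesis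
        unfolding m q_def using True by (simp add: ennreal_mult'[OF A] distrib_left mult_ac)
    qed (simp add: q_def)
  qed
  also have "\<dots> = ennreal A * ((integral\<^sup>N lborel (q 0) + integral\<^sup>N lborel (q 2))
      + ennreal (real CARD('d)) * integral\<^sup>N lborel (q 1))"
    by (simp add: nn_integral_add nn_integral_cmult)
  also have "\<dots> < \<top>"
    using q_finite by (simp add: ennreal_mult_less_top)
  finally show ?thesis .
qed

lemma square_norm_add_le:
  fixes a b :: "'a::real_inner"
  shows "(norm (a + b))\<^sup>2 \<le> 2 * (norm a)\<^sup>2 + 2 * (norm b)\<^sup>2"
  using zero_le_power2[of "norm (a - b)"]
  by (simp add: power2_norm_eq_inner inner_add_left inner_add_right inner_diff_left
      inner_diff_right inner_commute)

text \<open>From the origin and without control, the state is \<open>t \<mu> + \<sigma> B\<^sub>t\<close>, so quadratic growth of the running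
  cost turns into quadratic growth in \<open>t\<close> and \<open>B\<^sub>t\<close>.\<close>

lemma passive_player_cost_finite:
  fixes B :: "real \<Rightarrow> 'w \<Rightarrow> real ^ 'd" and h :: "'n::finite \<Rightarrow> real ^ 'n \<Rightarrow> real"
  assumes F: "filtered_prob_space M F" and B: "brownian_motion M F B" and \<rho>: "0 < \<rho>"
    and growth: "\<And>y. h i y \<le> K * (1 + (norm y)\<^sup>2)"
  shows "player_cost M \<mu> \<sigma> B \<rho> h Kp Km i 0 (\<lambda>_. (\<lambda>_ _. 0, \<lambda>_ _. 0)) < \<top>"
proof -
  let ?X = "state \<mu> \<sigma> B 0 (\<lambda>_. (\<lambda>_ _. 0, \<lambda>_ _. 0))"
  \<comment> \<open>The constant arises from \<open>\<parallel>t \<mu> + \<sigma> b\<parallel>\<^sup>2 \<le> 2 t\<^sup>2 \<parallel>\<mu>\<parallel>\<^sup>2 + 2 S\<^sup>2 \<parallel>b\<parallel>\<^sup>2\<close>.\<close>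
  define S where "S = onorm ((*v) \<sigma>)"
  define A where "A = \<bar>K\<bar> * (1 + 2 * (norm \<mu>)\<^sup>2 + 2 * S\<^sup>2)"
  have "0 \<le> A"
    by (simp add: A_def)
  have X: "?X t \<omega> = t *\<^sub>R \<mu> + \<sigma> *v B t \<omega>" for t \<omega>
    by (simp add: state_def vec_eq_iff matrix_mult_dot)
  have h: "h i (?X t \<omega>) \<le> A * (1 + t\<^sup>2 + (norm (B t \<omega>))\<^sup>2)" for t \<omega>
  proof -
    let ?b = "norm (B t \<omega>)"
    have "norm (\<sigma> *v B t \<omega>) \<le> S * ?b"
      unfolding S_def by (rule onorm[OF matrix_vector_mul_bounded_linear])
    then have \<sigma>: "(norm (\<sigma> *v B t \<omega>))\<^sup>2 \<le> S\<^sup>2 * ?b\<^sup>2"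
      by (simp add: power_mono flip: power_mult_distrib)
    have "(norm (?X t \<omega>))\<^sup>2 \<le> 2 * (norm (t *\<^sub>R \<mu>))\<^sup>2 + 2 * (norm (\<sigma> *v B t \<omega>))\<^sup>2"
      unfolding X by (rule square_norm_add_le)
    also have "\<dots> \<le> 2 * (norm \<mu>)\<^sup>2 * t\<^sup>2 + 2 * S\<^sup>2 * ?b\<^sup>2"
      using \<sigma> by (simp add: power_mult_distrib mult_ac)
    finally have "1 + (norm (?X t \<omega>))\<^sup>2 \<le> 1 + 2 * (norm \<mu>)\<^sup>2 * t\<^sup>2 + 2 * S\<^sup>2 * ?b\<^sup>2"
      by simp
    also have "\<dots> \<le> (1 + 2 * (norm \<mu>)\<^sup>2 + 2 * S\<^sup>2) * (1 + t\<^sup>2 + ?b\<^sup>2)"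
      by (simp add: algebra_simps)
    finally have "\<bar>K\<bar> * (1 + (norm (?X t \<omega>))\<^sup>2) \<le> A * (1 + t\<^sup>2 + ?b\<^sup>2)"
      unfolding A_def mult.assoc by (rule mult_left_mono) simp
    moreover have "h i (?X t \<omega>) \<le> \<bar>K\<bar> * (1 + (norm (?X t \<omega>))\<^sup>2)"
      by (rule order_trans[OF growth]) (simp add: mult_right_mono)
    ultimately show ?thesis
      by simp
  qed
  have "player_cost M \<mu> \<sigma> B \<rho> h Kp Km i 0 (\<lambda>_. (\<lambda>_ _. 0, \<lambda>_ _. 0))
      = (\<integral>\<^sup>+ \<omega>. (\<integral>\<^sup>+ t\<in>{0..}. ennreal (exp (- \<rho> * t) * h i (?X t \<omega>)) \<partial>lborel) \<partial>M)"
    by (simp add: player_cost_def discounted_variation_zero)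
  also have "\<dots> \<le> (\<integral>\<^sup>+ \<omega>. (\<integral>\<^sup>+ t\<in>{0..}. ennreal (A * exp (- \<rho> * t)) *
      ennreal (1 + t\<^sup>2 + (norm (B t \<omega>))\<^sup>2) \<partial>lborel) \<partial>M)"
  proof (intro nn_integral_mono mult_right_mono)
    fix \<omega> t
    have "exp (- \<rho> * t) * h i (?X t \<omega>) \<le> (A * exp (- \<rho> * t)) * (1 + t\<^sup>2 + (norm (B t \<omega>))\<^sup>2)"
      using mult_left_mono[OF h, of "exp (- \<rho> * t)" t \<omega>] by (simp add: mult_ac)
    then show "ennreal (exp (- \<rho> * t) * h i (?X t \<omega>))
        \<le> ennreal (A * exp (- \<rho> * t)) * ennreal (1 + t\<^sup>2 + (norm (B t \<omega>))\<^sup>2)"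
      using \<open>0 \<le> A\<close> by (subst ennreal_mult[symmetric]) (auto intro: ennreal_leI)
  qed simp
  also have "\<dots> < \<top>"
    by (rule discounted_quadratic_growth_finite[OF F B \<rho> \<open>0 \<le> A\<close>])
  finally show ?thesis .
qed

section \<open>Optimal controls of the regulator are Pareto optimal\<close>

theorem theorem12:
  fixes M :: "'w measure"
    and F :: "real \<Rightarrow> 'w measure"
    and B :: "real \<Rightarrow> 'w \<Rightarrow> real ^ 'd"
    and \<mu> :: "real ^ 'n"
    and \<sigma> :: "real ^ 'd ^ 'n"
    and lam \<rho> c C :: real
    and h :: "'n \<Rightarrow> real ^ 'n \<Rightarrow> real"
    and Kp Km L :: "'n \<Rightarrow> real"
    and \<xi>' :: "real ^ 'n \<Rightarrow> 'n \<Rightarrow> 'w control"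
  assumes "filtered_prob_space M F"
    and "brownian_motion M F B"
    and "lam > 0"
    and "\<And>y. lam * (y \<bullet> y) \<le> y \<bullet> ((\<sigma> ** transpose \<sigma>) *v y)"
    and "\<rho> > 0"
    and "\<And>i. Kp i > 0" and "\<And>i. Km i > 0"
    and "\<And>i x. 0 \<le> h i x"
    and "\<And>i. L i > 0" and "(\<Sum>i\<in>UNIV. L i) = 1"
    and "0 < c" and "c < C"
    and "assumption_A1 C (aggregate_cost L h)"
    and "assumption_A2 C (aggregate_cost L h)"
    and "assumption_A3 c C (aggregate_cost L h)"
    and "optimal_control (admissible_controls M F \<rho>)
           (regulator_cost L (player_cost M \<mu> \<sigma> B \<rho> h Kp Km)) \<xi>'"
  shows "pareto_optimal (admissible_controls M F \<rho>) (player_cost M \<mu> \<sigma> B \<rho> h Kp Km) \<xi>'"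
proof (rule regulator_optimal_imp_pareto_optimal)
  let ?U = "admissible_controls M F \<rho> :: ('n \<Rightarrow> 'w control) set"
  let ?J = "player_cost M \<mu> \<sigma> B \<rho> h Kp Km"
  let ?passive = "\<lambda>_::'n. (\<lambda>_ _. 0, \<lambda>_ _. 0) :: 'w control"
  show "0 < L i" for i
    by fact
  show "optimal_control ?U (regulator_cost L ?J) \<xi>'"
    by fact
  \<comment> \<open>The other players' running costs are nonnegative, so A1 for the aggregate bounds each one.\<close>
  have "h i y \<le> C / L i * (1 + (norm y)\<^sup>2)" for i y
  proof -
    have "L i * h i y \<le> aggregate_cost L h y"
      unfolding aggregate_cost_def
      using less_imp_le[OF \<open>\<And>i. L i > 0\<close>] \<open>\<And>i x. 0 \<le> h i x\<close>
      by (intro member_le_sum mult_nonneg_nonneg) auto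
    also have "\<dots> \<le> C * (1 + (norm y)\<^sup>2)"
      using \<open>assumption_A1 C (aggregate_cost L h)\<close> by (simp add: assumption_A1_def)
    finally show ?thesis
      using \<open>\<And>i. L i > 0\<close>[of i] by (simp add: field_simps)
  qed
  then have "?J i 0 ?passive < \<top>" for i
    using \<open>filtered_prob_space M F\<close> \<open>brownian_motion M F B\<close> \<open>\<rho> > 0\<close>
    by (intro passive_player_cost_finite)
  then have "regulator_cost L ?J 0 ?passive < \<top>"
    by (simp add: regulator_cost_def ennreal_mult_less_top)
  moreover have "value_function ?U (regulator_cost L ?J) 0 \<le> regulator_cost L ?J 0 ?passive"
    unfolding value_function_def by (intro INF_lower zero_control_admissible)
  ultimately show "value_function ?U (regulator_cost L ?J) 0 < \<top>"
    by (rule le_less_trans[rotated])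
qed

end
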